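(* Let $X$ be a uniformly convex and uniformly smooth Banach space and let $K$ be a closed, convex and pointed cone in $X$. Then $P_K$ is positive homogeneous, i.e. $P_K(tx)=tP_K(x)$ for all $x\in X$ and $t>0$. However, in general $\langle Jw,P_Kw\rangle\ne\|P_Kw\|_X^2$ for $w\in X$; that is, there exist a uniformly convex and uniformly smooth Banach space $X$, a closed, convex and pointed cone $K$ in $X$, and a point $w\in X$ such that $\langle Jw,P_Kw\rangle\neq\|P_Kw\|_X^2$.
   Context: Banach spaces are real; $\theta$ is the null element of $X$; $\langle\cdot,\cdot\rangle$ is the duality pairing between $X^*$ and $X$. The normalized duality mapping $J:X\to X^*$ is the single-valued map determined by $\langle Jx,x\rangle=\|Jx\|_{X^*}^2=\|x\|_X^2$. A cone with vertex $v$ is a set $K$ containing $v$ such that $v+t(x-v)\in K$ for all $x\in K$, $t\ge0$. A cone $K$ is pointed if it has vertex at $\theta$, $K\cap(-K)=\{\theta\}$ and $K\ne\{\theta\}$. For $C\subseteq X$ nonempty, closed and convex, the metric projection $P_C:X\to C$ is the map such that $\|x-P_Cx\|\le\|x-z\|$ for all $z\in C$. *)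

theory Defs
  imports "HOL-Analysis.Analysis"
begin

text \<open>
  A Banach space is a linear subspace X of some real vector space, together with a norm N on X.
  The class \<^class>\<open>banach\<close> would not allow quantification over spaces inside a formula, since the
  type determines both the carrier and the norm. A Banach space in the sense of that class is the
  case X = UNIV, N = norm; the lemmas below check that the notions then agree with the library.
  The values of N outside X are irrelevant.
\<close>

text \<open>The conditional only serves the axioms of \<^locale>\<open>Metric_space\<close> that are not
  relativized to the carrier.\<close>

definition norm_dist :: "'a::real_vector set \<Rightarrow> ('a \<Rightarrow> real) \<Rightarrow> 'a \<Rightarrow> 'a \<Rightarrow> real" where
  "norm_dist X N x y = (if x \<in> X \<and> y \<in> X then N (x - y) else 0)"

abbreviation norm_topology :: "'a::real_vector set \<Rightarrow> ('a \<Rightarrow> real) \<Rightarrow> 'a topology" where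
  "norm_topology X N \<equiv> Metric_space.mtopology X (norm_dist X N)"

locale normed_space_on =
  fixes X :: "'a::real_vector set" and N :: "'a \<Rightarrow> real"
  assumes subspace_carrier: "subspace X"
    and norm_on_nonneg: "x \<in> X \<Longrightarrow> 0 \<le> N x"
    and norm_on_eq_zero: "x \<in> X \<Longrightarrow> N x = 0 \<longleftrightarrow> x = 0"
    and norm_on_scaleR: "x \<in> X \<Longrightarrow> N (c *\<^sub>R x) = \<bar>c\<bar> * N x"
    and norm_on_triangle: "x \<in> X \<Longrightarrow> y \<in> X \<Longrightarrow> N (x + y) \<le> N x + N y"
begin

lemma Metric_space_norm_dist: "Metric_space X (norm_dist X N)"
proof
  have diff: "x - y \<in> X" if "x \<in> X" "y \<in> X" for x y
    using that subspace_carrier by (simp add: subspace_diff)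
  have sym: "N (x - y) = N (y - x)" if "x \<in> X" "y \<in> X" for x y
    using norm_on_scaleR[OF diff[OF that], of "-1"] by simp
  fix x y z
  show "0 \<le> norm_dist X N x y"
    by (simp add: norm_dist_def diff norm_on_nonneg)
  show "norm_dist X N x y = norm_dist X N y x"
    by (auto simp: norm_dist_def sym)
  show "norm_dist X N x y = 0 \<longleftrightarrow> x = y" if "x \<in> X" "y \<in> X"
    using that by (simp add: norm_dist_def diff norm_on_eq_zero)
  show "norm_dist X N x z \<le> norm_dist X N x y + norm_dist X N y z"
    if "x \<in> X" "y \<in> X" "z \<in> X"
    using that norm_on_triangle[OF diff[of x y] diff[of y z]] by (simp add: norm_dist_def)
qed

end

locale banach_space_on = normed_space_on +
  assumes complete_carrier: "Metric_space.mcomplete X (norm_dist X N)"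

definition uniformly_convex_on :: "'a::real_vector set \<Rightarrow> ('a \<Rightarrow> real) \<Rightarrow> bool" where
  "uniformly_convex_on X N \<longleftrightarrow>
    (\<forall>\<epsilon>>0. \<exists>\<delta>>0. \<forall>x\<in>X. \<forall>y\<in>X. N x = 1 \<longrightarrow> N y = 1 \<longrightarrow> \<epsilon> \<le> N (x - y)
      \<longrightarrow> N ((1/2) *\<^sub>R (x + y)) \<le> 1 - \<delta>)"

text \<open>This says that the modulus of smoothness, rho(t) = the supremum of
  (|x + y| + |x - y|) / 2 - 1 over |x| = 1 and |y| = t, satisfies rho(t) / t -> 0 as t -> 0+.\<close>

definition uniformly_smooth_on :: "'a::real_vector set \<Rightarrow> ('a \<Rightarrow> real) \<Rightarrow> bool" where
  "uniformly_smooth_on X N \<longleftrightarrow>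
    (\<forall>\<epsilon>>0. \<exists>\<delta>>0. \<forall>x\<in>X. \<forall>y\<in>X. N x = 1 \<longrightarrow> N y \<le> \<delta>
      \<longrightarrow> (N (x + y) + N (x - y)) / 2 - 1 \<le> \<epsilon> * N y)"

text \<open>Functionals on X are represented by functions that are \<^const>\<open>undefined\<close> outside X, so
  that a functional is determined by its values on X.\<close>

definition dual_space :: "'a::real_vector set \<Rightarrow> ('a \<Rightarrow> real) \<Rightarrow> ('a \<Rightarrow> real) set" where
  "dual_space X N = {f \<in> extensional X.
     (\<forall>x\<in>X. \<forall>y\<in>X. f (x + y) = f x + f y) \<and>
     (\<forall>x\<in>X. \<forall>c. f (c *\<^sub>R x) = c * f x) \<and>
     (\<exists>B. \<forall>x\<in>X. \<bar>f x\<bar> \<le> B * N x)}"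

definition dual_norm :: "'a::real_vector set \<Rightarrow> ('a \<Rightarrow> real) \<Rightarrow> ('a \<Rightarrow> real) \<Rightarrow> real" where
  "dual_norm X N f = (SUP x\<in>{x \<in> X. N x \<le> 1}. \<bar>f x\<bar>)"

text \<open>The two uses of \<^term>\<open>The\<close> below are meaningful on the spaces considered: J is everywhere
  defined by the Hahn-Banach theorem and single-valued on a smooth space, and the nearest point of
  a nonempty closed convex set exists and is unique in a uniformly convex Banach space.\<close>

definition duality_map :: "'a::real_vector set \<Rightarrow> ('a \<Rightarrow> real) \<Rightarrow> 'a \<Rightarrow> 'a \<Rightarrow> real" where
  "duality_map X N x =
    (THE f. f \<in> dual_space X N \<and> f x = (dual_norm X N f)\<^sup>2 \<and> f x = (N x)\<^sup>2)"

definition metric_projection :: "('a::real_vector \<Rightarrow> real) \<Rightarrow> 'a set \<Rightarrow> 'a \<Rightarrow> 'a" where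
  "metric_projection N C x = (THE p. p \<in> C \<and> (\<forall>z\<in>C. N (x - p) \<le> N (x - z)))"

definition cone_with_vertex :: "'a::real_vector \<Rightarrow> 'a set \<Rightarrow> bool" where
  "cone_with_vertex v K \<longleftrightarrow> v \<in> K \<and> (\<forall>x\<in>K. \<forall>t\<ge>0. v + t *\<^sub>R (x - v) \<in> K)"

definition pointed_cone :: "'a::real_vector set \<Rightarrow> bool" where
  "pointed_cone K \<longleftrightarrow> cone_with_vertex 0 K \<and> K \<inter> uminus ` K = {0} \<and> K \<noteq> {0}"

lemma norm_dist_UNIV: "norm_dist UNIV norm = (dist :: 'a::real_normed_vector \<Rightarrow> 'a \<Rightarrow> real)"
  by (simp add: norm_dist_def fun_eq_iff dist_norm)

lemma closedin_norm_topology_UNIV: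
  "closedin (norm_topology UNIV norm) (K :: 'a::real_normed_vector set) \<longleftrightarrow> closed K"
  by (simp add: norm_dist_UNIV)

lemma banach_space_on_UNIV: "banach_space_on UNIV (norm :: 'a::banach \<Rightarrow> real)"
proof
  show "Metric_space.mcomplete UNIV (norm_dist UNIV (norm :: 'a \<Rightarrow> real))"
    using complete_UNIV by (simp add: norm_dist_UNIV)
qed (auto simp: norm_triangle_ineq)

lemma dual_space_UNIV:
  "dual_space UNIV norm = {f :: 'a::real_normed_vector \<Rightarrow> real. bounded_linear f}"
  by (auto simp: dual_space_def bounded_linear_def bounded_linear_axioms_def linear_iff
      real_norm_def mult.commute)

lemma dual_norm_UNIV:
  fixes f :: "'a::real_normed_vector \<Rightarrow> real"
  assumes "bounded_linear f"
  shows "dual_norm UNIV norm f = onorm f"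
proof -
  interpret bounded_linear f by fact
  have le: "\<bar>f x\<bar> \<le> onorm f" if "norm x \<le> 1" for x
  proof -
    have "\<bar>f x\<bar> \<le> onorm f * norm x" using onorm[OF assms, of x] by simp
    also have "\<dots> \<le> onorm f" using that onorm_pos_le[OF assms] by (simp add: mult_left_le)
    finally show ?thesis .
  qed
  have bdd: "bdd_above ((\<lambda>x. \<bar>f x\<bar>) ` {x. norm x \<le> 1})"
    using le by (intro bdd_aboveI[of _ "onorm f"]) auto
  show ?thesis
  proof (rule antisym)
    show "dual_norm UNIV norm f \<le> onorm f"
      unfolding dual_norm_def using le by (intro cSUP_least) (auto intro: exI[of _ 0])
    show "onorm f \<le> dual_norm UNIV norm f"
      unfolding onorm_def
    proof (rule cSUP_least)
      fix x
      have "norm (f x) / norm x = \<bar>f (x /\<^sub>R norm x)\<bar>"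
        by (simp add: scaleR abs_mult divide_inverse mult.commute)
      also have "\<dots> \<le> dual_norm UNIV norm f"
        unfolding dual_norm_def using bdd by (intro cSUP_upper) (cases "x = 0"; simp)+
      finally show "norm (f x) / norm x \<le> dual_norm UNIV norm f" .
    qed simp
  qed
qed

end

theory Submission
  imports Defs
begin

text \<open>
  Homogeneity: in a uniformly convex Banach space the nearest point in K exists and is unique, and
  for t > 0 the map z \<mapsto> t z is a bijection of the cone K that multiplies distances by t, so it sends
  the nearest point to x to the nearest point to t x.

  Counterexample: in the plane with norm \<open>(a^4 + b^4)^(1/4)\<close> take K = \<open>{(s, s). s \<ge> 0}\<close> and w = (1, 0). Then
  J w = (1, 0), and \<open>(1 - s)^4 + s^4\<close> is minimal at s = 1/2, so P w = (1/2, 1/2). Hence the pairing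
  of J w with P w is 1/2, while \<open>\<parallel>P w\<parallel>^4 = 1/8 \<noteq> (1/2)^2\<close>. Uniform convexity and smoothness come from
  \<open>((a+b)/2)^4 + ((a-b)/2)^4 \<le> (a^4 + b^4)/2\<close>, applied to coordinates and to norms respectively.
\<close>

section \<open>Norm arithmetic on a carrier subspace\<close>

sublocale normed_space_on \<subseteq> metric: Metric_space X "norm_dist X N"
  by (rule Metric_space_norm_dist)

context normed_space_on
begin

lemma add_mem: "x \<in> X \<Longrightarrow> y \<in> X \<Longrightarrow> x + y \<in> X"
  using subspace_carrier by (rule subspace_add)

lemma diff_mem: "x \<in> X \<Longrightarrow> y \<in> X \<Longrightarrow> x - y \<in> X"
  using subspace_carrier by (rule subspace_diff)

lemma scaleR_mem: "x \<in> X \<Longrightarrow> c *\<^sub>R x \<in> X"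
  using subspace_carrier by (rule subspace_scale)

lemma norm_on_minus: "x \<in> X \<Longrightarrow> N (- x) = N x"
  using norm_on_scaleR[of x "-1"] by simp

lemma norm_on_commute: "x \<in> X \<Longrightarrow> y \<in> X \<Longrightarrow> N (x - y) = N (y - x)"
  using norm_on_minus[OF diff_mem[of x y]] by simp

section \<open>Nearest points under uniform convexity\<close>

text \<open>If \<open>y\<close> and \<open>z\<close> are almost nearest to \<open>x\<close>, a
  suitable point \<open>m\<close> of the segment between them still has distance at least
  \<open>d\<close> from \<open>x\<close>. This keeps the midpoint of the normalized vectors
  \<open>x - y\<close> and \<open>x - z\<close> near the unit sphere, so uniform convexity makes
  their directions close. The lemma yields both the Cauchy property of minimizing sequences and
  uniqueness.\<close>

lemma near_minimizers_close:
  assumes uc: "uniformly_convex_on X N" and KX: "K \<subseteq> X" and "convex K" and x: "x \<in> X"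
    and lower: "\<And>z. z \<in> K \<Longrightarrow> d \<le> N (x - z)" and "0 \<le> d" and "0 < e"
  obtains h where "0 < h"
    "\<And>y z. y \<in> K \<Longrightarrow> z \<in> K \<Longrightarrow> N (x - y) < d + h \<Longrightarrow> N (x - z) < d + h \<Longrightarrow> N (y - z) < e"
proof (cases "d = 0")
  \<comment> \<open>For \<open>d = 0\<close> the distances may vanish and cannot be normalized, but
    then the triangle inequality through \<open>x\<close> is enough.\<close>
  case True
  have "N (y - z) < e" if "y \<in> K" "z \<in> K" "N (x - y) < d + e/2" "N (x - z) < d + e/2" for y z
  proof -
    have yz: "y \<in> X" "z \<in> X" using that KX by auto
    have "N ((x - z) + (y - x)) \<le> N (x - z) + N (y - x)"
      by (intro norm_on_triangle diff_mem x yz)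
    then show ?thesis using that True norm_on_commute[OF x yz(1)] by simp
  qed
  then show ?thesis using that[of "e/2"] \<open>0 < e\<close> by simp
next
  case False
  with \<open>0 \<le> d\<close> have d: "0 < d" by simp
  define eps where "eps = e / (2 * (d + 1))"
  have eps: "0 < eps" using d \<open>0 < e\<close> by (simp add: eps_def)
  from uc eps obtain dl where dl: "0 < dl"
    and uc': "\<And>u v. u \<in> X \<Longrightarrow> v \<in> X \<Longrightarrow> N u = 1 \<Longrightarrow> N v = 1 \<Longrightarrow> eps \<le> N (u - v)
      \<Longrightarrow> N ((1/2) *\<^sub>R (u + v)) \<le> 1 - dl"
    unfolding uniformly_convex_on_def by metis
  \<comment> \<open>The three bounds on \<open>h\<close> have separate uses:
    \<open>h \<le> 1\<close> bounds the distances by \<open>d + 1\<close>,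
    \<open>h \<le> e/2\<close> bounds their difference, and \<open>h < dl * d\<close> gives
    \<open>1 - dl < d / (d + h)\<close>.\<close>
  define h where "h = min (min 1 (e/2)) (dl * d / 2)"
  have h: "0 < h" "h \<le> 1" "h \<le> e/2" "h < dl * d"
    using dl d \<open>0 < e\<close> by (auto simp: h_def min_less_iff_disj)
  have "N (y - z) < e" if yz: "y \<in> K" "z \<in> K" "N (x - y) < d + h" "N (x - z) < d + h" for y z
  proof -
    define a b where "a = N (x - y)" and "b = N (x - z)"
    have ab: "d \<le> a" "d \<le> b" "a < d + h" "b < d + h" "0 < a" "0 < b"
      using yz lower[of y] lower[of z] d by (auto simp: a_def b_def)
    have X: "y \<in> X" "z \<in> X" "x - y \<in> X" "x - z \<in> X"
      using yz KX x by (auto intro: diff_mem)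
    define u v where "u = (1/a) *\<^sub>R (x - y)" and "v = (1/b) *\<^sub>R (x - z)"
    have uv: "u \<in> X" "v \<in> X" "N u = 1" "N v = 1"
      using X ab by (auto simp: u_def v_def scaleR_mem norm_on_scaleR simp flip: a_def b_def)
    \<comment> \<open>The weights are proportional to \<open>1/a\<close> for \<open>y\<close> and
      \<open>1/b\<close> for \<open>z\<close>, which makes \<open>u + v\<close> a multiple of
      \<open>x - m\<close>.\<close>
    define m where "m = (b/(a+b)) *\<^sub>R y + (a/(a+b)) *\<^sub>R z"
    have m: "m \<in> K"
      unfolding m_def using \<open>convex K\<close> yz ab by (intro convexD) (auto simp flip: add_divide_distrib)
    have "((a+b)/(a*b)) *\<^sub>R m = (1/a) *\<^sub>R y + (1/b) *\<^sub>R z"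
      using ab by (simp add: m_def scaleR_add_right)
    moreover have "((a+b)/(a*b)) = 1/a + 1/b" using ab by (simp add: field_simps)
    ultimately have "(1/a + 1/b) *\<^sub>R m = (1/a) *\<^sub>R y + (1/b) *\<^sub>R z" by metis
    then have "u + v = (1/a + 1/b) *\<^sub>R (x - m)"
      unfolding scaleR_diff_right[of "1/a + 1/b"]
      by (simp only: u_def v_def scaleR_diff_right scaleR_left_distrib) simp
    then have sum: "(1/2) *\<^sub>R (u + v) = ((1/a + 1/b)/2) *\<^sub>R (x - m)" by simp
    have "1 - dl < d / (d + h)"
    proof -
      have "(1 - dl) * (d + h) = d + (h - dl * d) - dl * h" by (simp add: algebra_simps)
      also have "\<dots> < d" using h dl by (smt (verit) mult_pos_pos)
      finally show ?thesis using h d by (simp add: pos_less_divide_eq)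
    qed
    also have "\<dots> = ((1/(d+h) + 1/(d+h))/2) * d"
      by (simp only: add_divide_distrib field_sum_of_halves) simp
    also have "\<dots> \<le> ((1/a + 1/b)/2) * N (x - m)"
      using ab d h lower[OF m] by (intro mult_mono divide_right_mono add_mono frac_le) auto
    also have "\<dots> = N ((1/2) *\<^sub>R (u + v))"
      using ab m KX x by (subst sum, subst norm_on_scaleR) (auto intro: diff_mem)
    finally have "N (u - v) < eps" using uc'[of u v] uv by force
    then have uv_close: "N (v - u) < eps" using norm_on_commute uv by metis
    \<comment> \<open>The first summand measures the difference in direction, the second the
      difference in length; each contributes at most \<open>e/2\<close>.\<close>
    have "y - z = a *\<^sub>R (v - u) + (b - a) *\<^sub>R v"
    proof -
      have "a *\<^sub>R u = x - y" "b *\<^sub>R v = x - z" using ab by (simp_all add: u_def v_def)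
      then show ?thesis by (simp add: scaleR_diff_right scaleR_diff_left)
    qed
    then have "N (y - z) \<le> a * N (v - u) + \<bar>b - a\<bar>"
      using norm_on_triangle[of "a *\<^sub>R (v - u)" "(b - a) *\<^sub>R v"] uv ab
      by (simp add: scaleR_mem diff_mem norm_on_scaleR)
    also have "a * N (v - u) \<le> (d + 1) * eps"
      using ab h uv_close uv by (intro mult_mono) (auto intro: norm_on_nonneg diff_mem)
    also have "(d + 1) * eps = e/2" using d by (simp add: eps_def field_simps)
    finally show ?thesis using ab h by linarith
  qed
  then show ?thesis using that h by blast
qed

end

text \<open>A minimizing sequence is Cauchy by \<open>near_minimizers_close\<close>; its limit lies
  in the closed set \<open>K\<close> and attains the infimum \<open>d\<close>. Two minimizers lie
  within \<open>d + h\<close> of \<open>x\<close> for every \<open>h > 0\<close>, so the same lemma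
  makes them coincide.\<close>

lemma (in banach_space_on) nearest_point_unique_exists:
  assumes uc: "uniformly_convex_on X N" and KX: "K \<subseteq> X" and closed: "closedin (norm_topology X N) K"
    and "convex K" and "K \<noteq> {}" and x: "x \<in> X"
  shows "\<exists>!p. p \<in> K \<and> (\<forall>z\<in>K. N (x - p) \<le> N (x - z))"
proof -
  define d where "d = (INF z\<in>K. N (x - z))"
  have nonneg: "0 \<le> N (x - z)" if "z \<in> K" for z
    using that KX x by (auto intro: norm_on_nonneg diff_mem)
  then have bdd: "bdd_below ((\<lambda>z. N (x - z)) ` K)" by (auto intro: bdd_belowI[of _ 0])
  have lower: "d \<le> N (x - z)" if "z \<in> K" for z
    unfolding d_def using bdd that by (rule cINF_lower)
  have d0: "0 \<le> d" unfolding d_def using \<open>K \<noteq> {}\<close> nonneg by (rule cINF_greatest)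
  have approx: "\<exists>z\<in>K. N (x - z) < d + h" if "0 < h" for h
    using cINF_less_iff[OF \<open>K \<noteq> {}\<close> bdd, of "d + h"] that by (simp add: d_def)
  note close = near_minimizers_close[OF uc KX \<open>convex K\<close> x lower d0]
  obtain s where s: "\<And>n. s n \<in> K" "\<And>n. N (x - s n) < d + 1 / real (Suc n)"
    using approx[of "1 / real (Suc n)" for n] by (metis of_nat_0_less_iff zero_less_Suc zero_less_divide_1_iff)
  have sX: "s n \<in> X" for n using s KX by auto
  have "metric.MCauchy s"
    unfolding metric.MCauchy_def
  proof (intro conjI allI impI)
    fix e :: real assume "0 < e"
    then obtain h where h: "0 < h"
      "\<And>y z. y \<in> K \<Longrightarrow> z \<in> K \<Longrightarrow> N (x - y) < d + h \<Longrightarrow> N (x - z) < d + h \<Longrightarrow> N (y - z) < e"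
      using close by metis
    obtain M where M: "1 / real (Suc M) < h" using nat_approx_posE[OF h(1)] by blast
    have "N (x - s n) < d + h" if "M \<le> n" for n
    proof -
      have "1 / real (Suc n) \<le> 1 / real (Suc M)" using that by (intro frac_le) auto
      with s(2)[of n] M show ?thesis by linarith
    qed
    then show "\<exists>M. \<forall>n n'. M \<le> n \<longrightarrow> M \<le> n' \<longrightarrow> norm_dist X N (s n) (s n') < e"
      using h(2) s(1) sX by (intro exI[of _ M]) (simp add: norm_dist_def)
  qed (use sX in auto)
  with complete_carrier obtain p where p: "limitin (norm_topology X N) s p sequentially"
    unfolding metric.mcomplete_def by blast
  have pK: "p \<in> K"
    using limitin_closedin[OF p closed] s(1) by simp
  have pX: "p \<in> X" using pK KX by auto
  have p_le: "N (x - p) \<le> d"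
  proof (rule field_le_epsilon)
    fix e :: real assume "0 < e"
    then have "\<forall>\<^sub>F n in sequentially. s n \<in> X \<and> norm_dist X N (s n) p < e/2"
      using p unfolding metric.limitin_metric by (meson half_gt_zero)
    then have ev: "\<forall>\<^sub>F n in sequentially. N (s n - p) < e/2"
      by (rule eventually_mono) (auto simp: norm_dist_def pX)
    have "\<forall>\<^sub>F n in sequentially. 1 / real (Suc n) < e/2"
      using order_tendstoD(2)[OF LIMSEQ_inverse_real_of_nat, of "e/2"] \<open>0 < e\<close>
      by (simp add: inverse_eq_divide)
    with ev have "\<forall>\<^sub>F n in sequentially. N (s n - p) < e/2 \<and> 1 / real (Suc n) < e/2"
      by (rule eventually_conj)
    then obtain n where n: "N (s n - p) < e/2" "1 / real (Suc n) < e/2"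
      using eventually_happens'[OF sequentially_bot] by blast
    have "N (x - p) \<le> N (x - s n) + N (s n - p)"
      using norm_on_triangle[of "x - s n" "s n - p"] x sX pX by (simp add: diff_mem)
    then show "N (x - p) \<le> d + e" using n s(2)[of n] by linarith
  qed
  have unique: "q = p" if q: "q \<in> K" "N (x - q) \<le> d" for q
  proof -
    have qp: "q - p \<in> X" using q KX pX by (auto intro: diff_mem)
    have "N (q - p) < e" if "0 < e" for e
    proof -
      obtain h where h: "0 < h"
        "\<And>y z. y \<in> K \<Longrightarrow> z \<in> K \<Longrightarrow> N (x - y) < d + h \<Longrightarrow> N (x - z) < d + h \<Longrightarrow> N (y - z) < e"
        using close \<open>0 < e\<close> by metis
      show ?thesis using h(1) q p_le pK by (intro h(2)) auto
    qed
    \<comment> \<open>With \<open>e\<close> equal to \<open>N (q - p)\<close> itself, a positive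
      value would be less than itself.\<close>
    from this[of "N (q - p)"] have "N (q - p) = 0" using norm_on_nonneg[OF qp] by force
    then show ?thesis using norm_on_eq_zero[OF qp] by simp
  qed
  show ?thesis
  proof (rule ex1I)
    show "p \<in> K \<and> (\<forall>z\<in>K. N (x - p) \<le> N (x - z))"
      using pK order_trans[OF p_le lower] by blast
    show "q = p" if "q \<in> K \<and> (\<forall>z\<in>K. N (x - q) \<le> N (x - z))" for q
      using that pK p_le by (intro unique) (auto intro: order_trans)
  qed
qed

section \<open>Positive homogeneity of the projection\<close>

lemma (in banach_space_on) metric_projection_cone_scaleR:
  assumes uc: "uniformly_convex_on X N" and KX: "K \<subseteq> X" and closed: "closedin (norm_topology X N) K"
    and "convex K" and cone: "cone_with_vertex 0 K" and x: "x \<in> X" and t: "0 < t"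
  shows "metric_projection N K (t *\<^sub>R x) = t *\<^sub>R metric_projection N K x"
proof -
  have scale: "c *\<^sub>R z \<in> K" if "z \<in> K" "0 < c" for c z
    using cone that by (force simp: cone_with_vertex_def)
  have "K \<noteq> {}" using cone by (auto simp: cone_with_vertex_def)
  note ex1 = nearest_point_unique_exists[OF uc KX closed \<open>convex K\<close> \<open>K \<noteq> {}\<close>]
  define p where "p = metric_projection N K x"
  have p: "p \<in> K" "\<And>z. z \<in> K \<Longrightarrow> N (x - p) \<le> N (x - z)"
    using theI'[OF ex1[OF x]] by (auto simp: p_def metric_projection_def)
  have N_scale: "N (t *\<^sub>R x - t *\<^sub>R z) = t * N (x - z)" if "z \<in> K" for z
    using norm_on_scaleR[OF diff_mem[of x z], of t] that KX x t by (auto simp: scaleR_diff_right)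
  \<comment> \<open>A competitor \<open>z\<close> for the scaled point corresponds to the competitor
    \<open>(1/t) *\<^sub>R z\<close> for \<open>x\<close>, which is again in the cone.\<close>
  have "N (t *\<^sub>R x - t *\<^sub>R p) \<le> N (t *\<^sub>R x - z)" if "z \<in> K" for z
    using N_scale[OF p(1)] N_scale[OF scale[OF that, of "1/t"]] p(2)[OF scale[OF that, of "1/t"]] t
    by simp
  then have "metric_projection N K (t *\<^sub>R x) = t *\<^sub>R p"
    unfolding metric_projection_def
    by (intro the1_equality[OF ex1[OF scaleR_mem[OF x]]]) (auto intro: scale p t)
  then show ?thesis by (simp add: p_def)
qed


section \<open>The plane with the 4-norm\<close>

lemma quartic_le_imp_le: "a^4 \<le> b^4 \<Longrightarrow> 0 \<le> b \<Longrightarrow> a \<le> b" for a b :: real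
  by (rule power_le_imp_le_base[of a 3]) simp_all

text \<open>This is the scalar Clarkson inequality for exponent 4; the defect is a multiple of a
  square. It also locates the minimum in the computation of the projection.\<close>

lemma quartic_parallelogram: "((a + b)/2)^4 + ((a - b)/2)^4 \<le> (a^4 + b^4)/2" for a b :: real
proof -
  have "(a^4 + b^4)/2 - ((a + b)/2)^4 - ((a - b)/2)^4 = 3/8 * (a\<^sup>2 - b\<^sup>2)\<^sup>2"
    by (simp add: power2_eq_square power4_eq_xxxx field_simps)
  moreover have "0 \<le> 3/8 * (a\<^sup>2 - b\<^sup>2)\<^sup>2" by simp
  ultimately show ?thesis by linarith
qed

text \<open>Since \<open>nat\<close> is discrete, the ambient type is the space of bounded real
  sequences, and the sequences supported on the indices 0 and 1 form a copy of the plane. The norm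
  used on it is \<open>l4\<close>, not the supremum norm of the type.\<close>

definition plane :: "(nat \<Rightarrow>\<^sub>C real) set" where
  "plane = {f. \<forall>n\<ge>2. apply_bcontfun f n = 0}"

text \<open>Only two coordinates enter, so this is a norm on \<open>plane\<close> and merely a
  seminorm on the whole type. Hence definiteness needs membership in \<open>plane\<close>, while
  homogeneity and the triangle inequality hold everywhere.\<close>

definition l4 :: "(nat \<Rightarrow>\<^sub>C real) \<Rightarrow> real" where
  "l4 f = root 4 (apply_bcontfun f 0 ^ 4 + apply_bcontfun f 1 ^ 4)"

definition unit_vec :: "nat \<Rightarrow> (nat \<Rightarrow>\<^sub>C real)" where
  "unit_vec i = Bcontfun (\<lambda>n. if n = i then 1 else 0)"

lemma apply_unit_vec [simp]: "apply_bcontfun (unit_vec i) n = (if n = i then 1 else 0)"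
proof -
  have "(\<lambda>n. if n = i then 1 else 0 :: real) \<in> bcontfun"
    by (rule bcontfun_normI[of _ 1]) auto
  then show ?thesis by (simp add: unit_vec_def Bcontfun_inverse)
qed

lemma plane_eqI:
  assumes "f \<in> plane" "g \<in> plane" "apply_bcontfun f 0 = apply_bcontfun g 0"
    "apply_bcontfun f 1 = apply_bcontfun g 1"
  shows "f = g"
proof (rule bcontfun_eqI)
  fix n :: nat
  consider "n = 0" | "n = 1" | "2 \<le> n" by linarith
  then show "apply_bcontfun f n = apply_bcontfun g n" using assms by cases (auto simp: plane_def)
qed

lemma subspace_plane: "subspace plane"
  by (auto simp: subspace_def plane_def)

lemma unit_vec_in_plane: "i < 2 \<Longrightarrow> unit_vec i \<in> plane"
  by (auto simp: plane_def)

lemma l4_nonneg: "0 \<le> l4 f"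
  by (simp add: l4_def)

lemma l4_power4: "l4 f ^ 4 = apply_bcontfun f 0 ^ 4 + apply_bcontfun f 1 ^ 4"
  by (simp add: l4_def)

lemma l4_le_iff: "0 \<le> r \<Longrightarrow> l4 f \<le> r \<longleftrightarrow> apply_bcontfun f 0 ^ 4 + apply_bcontfun f 1 ^ 4 \<le> r ^ 4"
  by (metis l4_nonneg l4_power4 power_mono_iff zero_less_numeral)

lemma apply_le_l4:
  assumes "i < 2"
  shows "\<bar>apply_bcontfun f i\<bar> \<le> l4 f"
proof -
  have "i = 0 \<or> i = 1" using assms by linarith
  then have "\<bar>apply_bcontfun f i\<bar> ^ 4 \<le> l4 f ^ 4" by (auto simp: l4_power4)
  then show ?thesis using l4_nonneg by (rule quartic_le_imp_le)
qed

lemma l4_eq_0: "f \<in> plane \<Longrightarrow> l4 f = 0 \<longleftrightarrow> f = 0"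
  using apply_le_l4[of 0 f] apply_le_l4[of 1 f] by (auto intro: plane_eqI simp: plane_def) (simp add: l4_def)

lemma l4_scaleR: "l4 (c *\<^sub>R f) = \<bar>c\<bar> * l4 f"
proof (rule power_eq_imp_eq_base)
  show "l4 (c *\<^sub>R f) ^ 4 = (\<bar>c\<bar> * l4 f) ^ 4"
    by (simp add: l4_power4 power_mult_distrib distrib_left)
qed (auto simp: l4_nonneg)

text \<open>Minkowski's inequality from convexity of the fourth power:
  \<open>(a + b)/(s + r)\<close> is the convex combination of \<open>a/s\<close> and
  \<open>b/r\<close> with weights \<open>s/(s + r)\<close> and \<open>r/(s + r)\<close>. Vanishing
  norms are treated first because of these divisions.\<close>

lemma l4_triangle: "l4 (f + g) \<le> l4 f + l4 g"
proof -
  define s r where "s = l4 f" and "r = l4 g"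
  consider "s = 0" | "r = 0" | "0 < s" "0 < r" using l4_nonneg by (force simp: s_def r_def less_le)
  then show ?thesis
  proof cases
    case 1
    then have "apply_bcontfun f 0 = 0" "apply_bcontfun f 1 = 0"
      using apply_le_l4[of 0 f] apply_le_l4[of 1 f] by (auto simp: s_def)
    then show ?thesis using l4_nonneg[of f] by (simp add: l4_def)
  next
    case 2
    then have "apply_bcontfun g 0 = 0" "apply_bcontfun g 1 = 0"
      using apply_le_l4[of 0 g] apply_le_l4[of 1 g] by (auto simp: r_def)
    then show ?thesis using l4_nonneg[of g] by (simp add: l4_def)
  next
    case 3
    have conv: "(a + b)^4 \<le> (s + r)^3 * (a^4 / s^3 + b^4 / r^3)" for a b
    proof -
      have "convex_on UNIV (\<lambda>x::real. x^4)" by (rule convex_power_even) simp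
      from convex_onD[OF this, of "r/(s+r)" "a/s" "b/r"] 3
      have "((1 - r/(s+r)) * (a/s) + r/(s+r) * (b/r))^4
          \<le> (1 - r/(s+r)) * (a/s)^4 + r/(s+r) * (b/r)^4" by simp
      moreover have "1 - r/(s+r) = s/(s+r)" using 3 by (simp add: field_simps)
      moreover have "s/(s+r) * (a/s) + r/(s+r) * (b/r) = (a + b)/(s + r)"
        using 3 by (simp add: add_divide_distrib)
      moreover have "s/(s+r) * (a/s)^4 + r/(s+r) * (b/r)^4 = (a^4 / s^3 + b^4 / r^3)/(s + r)"
        using 3 by (simp add: power_divide add_divide_distrib power4_eq_xxxx power3_eq_cube mult_ac)
      ultimately have "(a + b)^4/(s + r)^4 \<le> (a^4 / s^3 + b^4 / r^3)/(s + r)"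
        by (simp only: power_divide)
      then have "(a + b)^4 \<le> (a^4 / s^3 + b^4 / r^3)/(s + r) * (s + r)^4"
        using 3 by (simp add: pos_divide_le_eq)
      also have "\<dots> = (s + r)^3 * (a^4 / s^3 + b^4 / r^3)"
        using 3 by (simp add: power4_eq_xxxx power3_eq_cube)
      finally show ?thesis .
    qed
    have "apply_bcontfun (f+g) 0 ^ 4 + apply_bcontfun (f+g) 1 ^ 4
        \<le> (s + r)^3 * (l4 f ^ 4 / s^3 + l4 g ^ 4 / r^3)"
      using conv[of "apply_bcontfun f 0" "apply_bcontfun g 0"]
        conv[of "apply_bcontfun f 1" "apply_bcontfun g 1"]
      by (simp add: l4_power4 add_divide_distrib distrib_left)
    \<comment> \<open>The second factor collapses to \<open>s + r\<close>, because \<open>s\<close>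
      and \<open>r\<close> are the norms themselves.\<close>
    also have "\<dots> = (s + r)^4"
      using 3 by (simp add: power4_eq_xxxx power3_eq_cube flip: s_def r_def)
    finally show ?thesis using 3 by (subst l4_le_iff) (auto simp: s_def r_def)
  qed
qed

lemma normed_space_on_plane: "normed_space_on plane l4"
  by unfold_locales (auto simp: subspace_plane l4_nonneg l4_eq_0 l4_scaleR l4_triangle)

interpretation plane: normed_space_on plane l4
  by (rule normed_space_on_plane)

section \<open>Coordinatewise convergence and completeness\<close>

text \<open>Each coordinate is dominated by \<open>l4\<close>, and conversely \<open>l4\<close>
  depends continuously on the two coordinates.\<close>

lemma limitin_plane_iff:
  "limitin plane.metric.mtopology s l sequentially \<longleftrightarrow>
    l \<in> plane \<and> (\<forall>\<^sub>F n in sequentially. s n \<in> plane) \<and>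
    (\<forall>i<2. (\<lambda>n. apply_bcontfun (s n) i) \<longlonglongrightarrow> apply_bcontfun l i)"
proof -
  \<comment> \<open>\<open>norm_dist\<close> is set to 0 off the carrier, so agreement with
    \<open>l4\<close> is guaranteed only once the sequence stays in \<open>plane\<close>.\<close>
  have dist: "(\<lambda>n. norm_dist plane l4 (s n) l) \<longlonglongrightarrow> 0 \<longleftrightarrow> (\<lambda>n. l4 (s n - l)) \<longlonglongrightarrow> 0"
    if "l \<in> plane" "\<forall>\<^sub>F n in sequentially. s n \<in> plane"
    by (rule tendsto_cong, rule eventually_mono[OF that(2)]) (simp add: norm_dist_def that(1))
  have "(\<lambda>n. apply_bcontfun (s n) i) \<longlonglongrightarrow> apply_bcontfun l i"
    if lim: "(\<lambda>n. l4 (s n - l)) \<longlonglongrightarrow> 0" and "i < 2" for i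
    using apply_le_l4[OF \<open>i < 2\<close>, of "s _ - l"]
    by (intro LIM_zero_cancel[OF Lim_null_comparison[OF _ lim]]) simp
  moreover have "(\<lambda>n. l4 (s n - l)) \<longlonglongrightarrow> 0"
    if lim: "\<forall>i<2. (\<lambda>n. apply_bcontfun (s n) i) \<longlonglongrightarrow> apply_bcontfun l i"
  proof -
    have "(\<lambda>n. l4 (s n - l)) \<longlonglongrightarrow> root 4 ((apply_bcontfun l 0 - apply_bcontfun l 0)^4
        + (apply_bcontfun l 1 - apply_bcontfun l 1)^4)"
      unfolding l4_def minus_bcontfun.rep_eq using lim by (intro tendsto_intros) auto
    then show ?thesis by simp
  qed
  ultimately show ?thesis
    unfolding plane.metric.limitin_metric_dist_null using dist by blast
qed

text \<open>Completeness comes from the reals: the coordinates of a Cauchy sequence converge, and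
  their limits are the coordinates of the limit.\<close>

lemma banach_space_on_plane: "banach_space_on plane l4"
proof
  show "plane.metric.mcomplete"
    unfolding plane.metric.mcomplete_def
  proof (intro allI impI)
    fix s assume s: "plane.metric.MCauchy s"
    then have mem: "s n \<in> plane" for n by (auto simp: plane.metric.MCauchy_def)
    have coordinate_Cauchy: "Cauchy (\<lambda>n. apply_bcontfun (s n) i)" if "i < 2" for i
    proof (rule metric_CauchyI)
      fix e :: real assume "0 < e"
      with s have "\<exists>M. \<forall>m n. M \<le> m \<longrightarrow> M \<le> n \<longrightarrow> l4 (s m - s n) < e"
        unfolding plane.metric.MCauchy_def by (simp add: norm_dist_def mem)
      then obtain M where M: "\<And>m n. M \<le> m \<Longrightarrow> M \<le> n \<Longrightarrow> l4 (s m - s n) < e" by blast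
      show "\<exists>M. \<forall>m\<ge>M. \<forall>n\<ge>M. dist (apply_bcontfun (s m) i) (apply_bcontfun (s n) i) < e"
      proof (intro exI allI impI)
        fix m n assume "M \<le> m" "M \<le> n"
        then show "dist (apply_bcontfun (s m) i) (apply_bcontfun (s n) i) < e"
          using apply_le_l4[OF that, of "s m - s n"] M[of m n] by (simp add: dist_real_def)
      qed
    qed
    define a where "a i = lim (\<lambda>n. apply_bcontfun (s n) i)" for i
    have a: "(\<lambda>n. apply_bcontfun (s n) i) \<longlonglongrightarrow> a i" if "i < 2" for i
      unfolding a_def using Cauchy_convergent[OF coordinate_Cauchy[OF that]]
      by (simp add: convergent_LIMSEQ_iff)
    define l where "l = a 0 *\<^sub>R unit_vec 0 + a 1 *\<^sub>R unit_vec 1"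
    have "l \<in> plane" by (auto simp: l_def plane_def)
    moreover have "apply_bcontfun l i = a i" if "i < 2" for i
    proof -
      have "i = 0 \<or> i = 1" using that by linarith
      then show ?thesis by (auto simp: l_def)
    qed
    ultimately show "\<exists>l. limitin plane.metric.mtopology s l sequentially"
      using a mem by (auto simp: limitin_plane_iff)
  qed
qed

section \<open>Uniform convexity and uniform smoothness\<close>

lemma uniformly_convex_on_plane: "uniformly_convex_on plane l4"
  unfolding uniformly_convex_on_def
proof (intro allI impI)
  fix e :: real assume "0 < e"
  \<comment> \<open>The quartic inequality bounds the fourth power of the midpoint's norm by
    \<open>1 - (e/2)^4 = 1 - 4 * d\<close>, and Bernoulli bounds this by
    \<open>(1 - d)^4\<close>.\<close>
  define d where "d = (e/2)^4 / 4"
  have "l4 ((1/2) *\<^sub>R (f + g)) \<le> 1 - d" if fg: "l4 f = 1" "l4 g = 1" "e \<le> l4 (f - g)" for f g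
  proof -
    have "l4 ((1/2) *\<^sub>R (f + g)) ^ 4 + l4 ((1/2) *\<^sub>R (f - g)) ^ 4 \<le> (l4 f ^ 4 + l4 g ^ 4)/2"
      using quartic_parallelogram[of "apply_bcontfun f 0" "apply_bcontfun g 0"]
        quartic_parallelogram[of "apply_bcontfun f 1" "apply_bcontfun g 1"]
      unfolding l4_power4 by simp
    moreover have "(e/2)^4 \<le> l4 ((1/2) *\<^sub>R (f - g)) ^ 4"
      using fg \<open>0 < e\<close> by (intro power_mono) (auto simp: l4_scaleR)
    ultimately have le: "l4 ((1/2) *\<^sub>R (f + g)) ^ 4 \<le> 1 - 4 * d" using fg by (simp add: d_def)
    moreover have "0 \<le> l4 ((1/2) *\<^sub>R (f + g)) ^ 4" by simp
    \<comment> \<open>The existence of \<open>f\<close> and \<open>g\<close> already limits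
      \<open>d\<close>; the bound serves Bernoulli's inequality and the sign of \<open>1 - d\<close>
      when the fourth root is taken.\<close>
    ultimately have "d \<le> 1" by linarith
    then have "1 - 4 * d \<le> (1 - d)^4" using Bernoulli_inequality[of "- d" 4] by simp
    with le have "l4 ((1/2) *\<^sub>R (f + g)) ^ 4 \<le> (1 - d)^4" by linarith
    then show ?thesis using \<open>d \<le> 1\<close> by (auto dest: quartic_le_imp_le)
  qed
  moreover have "0 < d" using \<open>0 < e\<close> by (simp add: d_def)
  ultimately show "\<exists>d>0. \<forall>f\<in>plane. \<forall>g\<in>plane. l4 f = 1 \<longrightarrow> l4 g = 1 \<longrightarrow> e \<le> l4 (f - g) \<longrightarrow>
      l4 ((1/2) *\<^sub>R (f + g)) \<le> 1 - d" by blast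
qed

text \<open>The mean of the two norms exceeds 1 by at most \<open>2 * s\<^sup>2\<close>, where
  \<open>s\<close> is the norm of the perturbation. This is at most \<open>e * s\<close> once
  \<open>s \<le> e/2\<close>.\<close>

lemma uniformly_smooth_on_plane: "uniformly_smooth_on plane l4"
  unfolding uniformly_smooth_on_def
proof (intro allI impI)
  fix e :: real assume "0 < e"
  have "(l4 (f + g) + l4 (f - g))/2 - 1 \<le> e * l4 g" if f: "l4 f = 1" and g: "l4 g \<le> e/2" for f g
  proof -
    define s where "s = l4 g"
    define a b c d where abcd: "a = apply_bcontfun f 0" "b = apply_bcontfun f 1"
      "c = apply_bcontfun g 0" "d = apply_bcontfun g 1"
    have ab: "a^4 + b^4 = 1" and cd: "c^4 + d^4 = s^4"
      using l4_power4[of f] l4_power4[of g] f by (simp_all add: abcd s_def)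
    \<comment> \<open>Lagrange's identity, giving Cauchy-Schwarz for the vectors of squared
      coordinates.\<close>
    have "(a\<^sup>2 * c\<^sup>2 + b\<^sup>2 * d\<^sup>2)\<^sup>2 = (a^4 + b^4) * (c^4 + d^4) - (a\<^sup>2 * d\<^sup>2 - b\<^sup>2 * c\<^sup>2)\<^sup>2"
      by (simp add: power2_eq_square power4_eq_xxxx algebra_simps)
    also have "\<dots> \<le> (s\<^sup>2)\<^sup>2" unfolding ab cd by simp
    finally have cs: "a\<^sup>2 * c\<^sup>2 + b\<^sup>2 * d\<^sup>2 \<le> s\<^sup>2" by (rule power2_le_imp_le) simp
    have "((l4 (f + g) + l4 (f - g))/2)^4 \<le> (l4 (f + g) ^ 4 + l4 (f - g) ^ 4)/2"
    proof -
      have "0 \<le> ((l4 (f + g) - l4 (f - g))/2)^4" by (rule zero_le_even_power) simp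
      then show ?thesis using quartic_parallelogram[of "l4 (f + g)" "l4 (f - g)"] by linarith
    qed
    \<comment> \<open>The terms of odd degree in the coordinates of \<open>g\<close> cancel between
      the sum and the difference.\<close>
    also have "\<dots> = (a^4 + b^4) + 6 * (a\<^sup>2 * c\<^sup>2 + b\<^sup>2 * d\<^sup>2) + (c^4 + d^4)"
      unfolding l4_power4 plus_bcontfun.rep_eq minus_bcontfun.rep_eq abcd[symmetric]
      by (simp add: power2_eq_square power4_eq_xxxx algebra_simps)
    also have "\<dots> \<le> 1 + 6 * s\<^sup>2 + s^4" using ab cd cs by simp
    also have "\<dots> \<le> (1 + 2 * s\<^sup>2)^4"
    proof -
      have "(1 + 2 * s\<^sup>2)^4 = 1 + 6 * s\<^sup>2 + s^4 + (2 * s\<^sup>2 + 23 * s^4 + 32 * s^6 + 16 * s^8)"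
        by (simp add: power2_eq_square power4_eq_xxxx eval_nat_numeral algebra_simps)
      moreover have "0 \<le> 2 * s\<^sup>2 + 23 * s^4 + 32 * s^6 + 16 * s^8"
        by (intro add_nonneg_nonneg) auto
      ultimately show ?thesis by linarith
    qed
    finally have "(l4 (f + g) + l4 (f - g))/2 \<le> 1 + 2 * s\<^sup>2"
      by (rule quartic_le_imp_le) simp
    also have "2 * s\<^sup>2 \<le> e * s"
      using mult_right_mono[OF g l4_nonneg[of g]] by (simp add: s_def power2_eq_square)
    finally show ?thesis by (simp add: s_def field_simps)
  qed
  then show "\<exists>d>0. \<forall>f\<in>plane. \<forall>g\<in>plane. l4 f = 1 \<longrightarrow> l4 g \<le> d \<longrightarrow>
      (l4 (f + g) + l4 (f - g))/2 - 1 \<le> e * l4 g"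
    using \<open>0 < e\<close> by (intro exI[of _ "e/2"]) auto
qed

section \<open>The diagonal ray and the projection onto it\<close>

definition diagonal_ray :: "(nat \<Rightarrow>\<^sub>C real) set" where
  "diagonal_ray = {f \<in> plane. apply_bcontfun f 0 = apply_bcontfun f 1 \<and> 0 \<le> apply_bcontfun f 0}"

text \<open>Limits are coordinatewise, and the equation and the inequality that cut out the ray pass
  to limits of real sequences.\<close>

lemma closedin_diagonal_ray: "closedin plane.metric.mtopology diagonal_ray"
  unfolding plane.metric.metric_closedin_iff_sequentially_closed
proof (intro conjI allI impI)
  show "diagonal_ray \<subseteq> plane" by (auto simp: diagonal_ray_def)
  fix s l assume s: "range s \<subseteq> diagonal_ray \<and> limitin plane.metric.mtopology s l sequentially"
  then have mem: "s n \<in> diagonal_ray" for n by auto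
  from s have l: "l \<in> plane" "(\<lambda>n. apply_bcontfun (s n) 0) \<longlonglongrightarrow> apply_bcontfun l 0"
    "(\<lambda>n. apply_bcontfun (s n) 1) \<longlonglongrightarrow> apply_bcontfun l 1"
    by (auto simp: limitin_plane_iff)
  have "0 \<le> apply_bcontfun (s n) 0" for n using mem[of n] by (simp add: diagonal_ray_def)
  then have "0 \<le> apply_bcontfun l 0" by (intro LIMSEQ_le_const[OF l(2)]) blast
  moreover have "apply_bcontfun l 0 = apply_bcontfun l 1"
    using l(2,3) mem by (intro LIMSEQ_unique) (auto simp: diagonal_ray_def)
  ultimately show "l \<in> diagonal_ray" using l(1) by (simp add: diagonal_ray_def)
qed

lemma convex_diagonal_ray: "convex diagonal_ray"
  by (rule convexI) (auto simp: diagonal_ray_def plane_def)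

lemma pointed_cone_diagonal_ray: "pointed_cone diagonal_ray"
proof -
  have "f = 0" if "f \<in> diagonal_ray" "- f \<in> diagonal_ray" for f
    using that by (intro plane_eqI) (auto simp: diagonal_ray_def plane_def)
  moreover have "unit_vec 0 + unit_vec 1 \<in> diagonal_ray"
    by (auto simp: diagonal_ray_def plane_def)
  moreover have "unit_vec 0 + unit_vec 1 \<noteq> 0"
    by (auto dest: arg_cong[of _ _ "\<lambda>f. apply_bcontfun f 0"])
  moreover have "cone_with_vertex 0 diagonal_ray"
    by (auto simp: cone_with_vertex_def diagonal_ray_def plane_def)
  ultimately show ?thesis
    by (auto simp: pointed_cone_def cone_with_vertex_def)
qed

lemma metric_projection_diagonal_ray:
  "metric_projection l4 diagonal_ray (unit_vec 0) = (1/2) *\<^sub>R (unit_vec 0 + unit_vec 1)"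
    (is "_ = ?p")
proof -
  interpret banach_space_on plane l4 by (rule banach_space_on_plane)
  have "diagonal_ray \<subseteq> plane" "diagonal_ray \<noteq> {}"
    using pointed_cone_diagonal_ray by (auto simp: diagonal_ray_def pointed_cone_def cone_with_vertex_def)
  note ex1 = nearest_point_unique_exists[OF uniformly_convex_on_plane this(1) closedin_diagonal_ray
      convex_diagonal_ray this(2) unit_vec_in_plane[of 0]]
  have "?p \<in> diagonal_ray" by (auto simp: diagonal_ray_def plane_def)
  moreover have "l4 (unit_vec 0 - ?p) \<le> l4 (unit_vec 0 - z)" if "z \<in> diagonal_ray" for z
  proof -
    define t where "t = apply_bcontfun z 0"
    have z: "apply_bcontfun z 0 = t" "apply_bcontfun z 1 = t"
      using that by (auto simp: diagonal_ray_def t_def)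
    \<comment> \<open>The numbers \<open>1 - t\<close> and \<open>t\<close> have midpoint 1/2 for
      every \<open>t\<close>, so dropping the difference term leaves the minimum
      \<open>2 * (1/2)^4 = 1/8\<close>.\<close>
    have "0 \<le> ((1 - 2 * t)/2)^4" by (rule zero_le_even_power) simp
    then have "1/8 \<le> (1 - t)^4 + t^4"
      using quartic_parallelogram[of "1 - t" t] by (simp add: power4_eq_xxxx)
    also have "\<dots> = l4 (unit_vec 0 - z) ^ 4" by (simp add: l4_power4 z del: One_nat_def)
    finally show ?thesis
      by (subst l4_le_iff) (auto simp: l4_nonneg power4_eq_xxxx)
  qed
  ultimately show ?thesis
    unfolding metric_projection_def by (intro the1_equality[OF ex1]) auto
qed

section \<open>The duality mapping at (1, 0)\<close>

text \<open>The coordinate functional satisfies the defining conditions, and any other candidate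
  \<open>j\<close> agrees with it at (1, 0). Uniqueness thus reduces to showing that
  \<open>j\<close> vanishes at (0, 1).\<close>

lemma duality_map_unit_vec:
  "duality_map plane l4 (unit_vec 0) = restrict (\<lambda>f. apply_bcontfun f 0) plane"
  unfolding duality_map_def
proof (rule the_equality)
  have N1: "l4 (unit_vec 0) = 1" by (simp add: l4_def)
  have e0: "unit_vec 0 \<in> plane" and e1: "unit_vec 1 \<in> plane" by (auto intro: unit_vec_in_plane)
  let ?J = "restrict (\<lambda>f. apply_bcontfun f 0) plane"
  have "?J \<in> dual_space plane l4"
    unfolding dual_space_def
    using apply_le_l4[of 0]
    by (auto simp: plane.add_mem plane.scaleR_mem intro!: exI[of _ 1])
  moreover have "dual_norm plane l4 ?J = 1"
    unfolding dual_norm_def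
  proof (rule cSup_eq_maximum)
    show "1 \<in> (\<lambda>f. \<bar>?J f\<bar>) ` {f \<in> plane. l4 f \<le> 1}"
      using e0 N1 by (intro image_eqI[of _ _ "unit_vec 0"]) auto
    show "y \<le> 1" if "y \<in> (\<lambda>f. \<bar>?J f\<bar>) ` {f \<in> plane. l4 f \<le> 1}" for y
    proof -
      from that obtain f where "f \<in> plane" "l4 f \<le> 1" "y = \<bar>apply_bcontfun f 0\<bar>" by auto
      then show ?thesis using apply_le_l4[of 0 f] by simp
    qed
  qed
  ultimately show "?J \<in> dual_space plane l4 \<and> ?J (unit_vec 0) = (dual_norm plane l4 ?J)\<^sup>2 \<and>
      ?J (unit_vec 0) = (l4 (unit_vec 0))\<^sup>2"
    using e0 N1 by simp
  fix j assume j: "j \<in> dual_space plane l4 \<and> j (unit_vec 0) = (dual_norm plane l4 j)\<^sup>2 \<and>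
      j (unit_vec 0) = (l4 (unit_vec 0))\<^sup>2"
  then have add: "\<And>f g. f \<in> plane \<Longrightarrow> g \<in> plane \<Longrightarrow> j (f + g) = j f + j g"
    and scale: "\<And>f c. f \<in> plane \<Longrightarrow> j (c *\<^sub>R f) = c * j f"
    and ext: "j \<in> extensional plane" and j0: "j (unit_vec 0) = 1" and "(dual_norm plane l4 j)\<^sup>2 = 1"
    using N1 by (auto simp: dual_space_def)
  \<comment> \<open>The square leaves the values 1 and -1, and both satisfy the bound.\<close>
  then have dn: "dual_norm plane l4 j \<le> 1" by (auto simp: power2_eq_1_iff)
  from j have "\<exists>B. \<forall>f\<in>plane. \<bar>j f\<bar> \<le> B * l4 f" by (simp add: dual_space_def)
  then obtain B where B: "\<And>f. f \<in> plane \<Longrightarrow> \<bar>j f\<bar> \<le> B * l4 f" by blast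
  have le1: "\<bar>j f\<bar> \<le> 1" if f: "f \<in> plane" "l4 f \<le> 1" for f
  proof -
    \<comment> \<open>Boundedness is what makes the supremum in \<open>dual_norm\<close> an actual
      upper bound.\<close>
    have "bdd_above ((\<lambda>f. \<bar>j f\<bar>) ` {f \<in> plane. l4 f \<le> 1})"
    proof (intro bdd_aboveI[of _ "\<bar>B\<bar>"], safe)
      fix g assume g: "g \<in> plane" "l4 g \<le> 1"
      have "\<bar>j g\<bar> \<le> \<bar>B\<bar> * 1"
        using B[OF g(1)]
      proof (rule order_trans)
        show "B * l4 g \<le> \<bar>B\<bar> * 1" using g l4_nonneg by (intro mult_mono) auto
      qed
      then show "\<bar>j g\<bar> \<le> \<bar>B\<bar>" by simp
    qed
    then have "\<bar>j f\<bar> \<le> dual_norm plane l4 j"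
      unfolding dual_norm_def using f by (intro cSUP_upper) auto
    then show ?thesis using dn by simp
  qed
  define b where "b = j (unit_vec 1)"
  have b: "\<bar>b\<bar> \<le> 1" unfolding b_def using e1 by (intro le1) (auto simp: l4_def)
  \<comment> \<open>Testing j against (1, b) gives \<open>1 + b^2 \<le> (1 + b^4)^(1/4)\<close>, which forces b = 0.\<close>
  define v where "v = unit_vec 0 + b *\<^sub>R unit_vec 1"
  have v: "v \<in> plane" unfolding v_def using e0 e1 by (intro plane.add_mem plane.scaleR_mem)
  have v4: "l4 v ^ 4 = 1 + b^4" by (simp add: l4_power4 v_def)
  have "0 < l4 v ^ 4" unfolding v4 by (intro add_pos_nonneg) auto
  then have "l4 v \<noteq> 0" by auto
  then have vpos: "0 < l4 v" using l4_nonneg[of v] by simp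
  have jv: "j v = 1 + b\<^sup>2"
  proof -
    have "j v = j (unit_vec 0) + b * j (unit_vec 1)"
      unfolding v_def using e0 e1 by (simp only: add scale plane.scaleR_mem)
    then show ?thesis by (simp add: j0 power2_eq_square b_def)
  qed
  have "\<bar>j ((1 / l4 v) *\<^sub>R v)\<bar> \<le> 1"
    using v vpos by (intro le1) (auto simp: plane.scaleR_mem l4_scaleR)
  then have "j v \<le> l4 v" using v vpos by (simp add: scale abs_le_iff)
  then have "(1 + b\<^sup>2)^4 \<le> 1 + b^4" unfolding v4[symmetric] jv by (intro power_mono) auto
  \<comment> \<open>Together with \<open>b^4 \<le> b\<^sup>2\<close>, which follows from
    \<open>\<bar>b\<bar> \<le> 1\<close>, this leaves \<open>3 * b\<^sup>2 \<le> 0\<close>.\<close>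
  moreover have "1 + 4 * b\<^sup>2 \<le> (1 + b\<^sup>2)^4"
    using Bernoulli_inequality[OF order_trans[OF _ zero_le_power2[of b]], of 4] by simp
  moreover have "b^4 \<le> b\<^sup>2"
  proof -
    have "b\<^sup>2 \<le> 1" using b by (simp add: abs_square_le_1)
    then have "b\<^sup>2 * b\<^sup>2 \<le> b\<^sup>2" by (intro mult_left_le) auto
    then show ?thesis by (simp add: power4_eq_xxxx power2_eq_square mult.assoc)
  qed
  ultimately have "b\<^sup>2 \<le> 0" by linarith
  then have b0: "b = 0" by simp
  show "j = ?J"
  proof (rule extensionalityI[OF ext])
    fix f assume f: "f \<in> plane"
    have "f = apply_bcontfun f 0 *\<^sub>R unit_vec 0 + apply_bcontfun f 1 *\<^sub>R unit_vec 1"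
      using f by (intro plane_eqI) (auto simp: plane_def)
    then have "j f = j (apply_bcontfun f 0 *\<^sub>R unit_vec 0 + apply_bcontfun f 1 *\<^sub>R unit_vec 1)"
      by (rule arg_cong)
    also have "\<dots> = apply_bcontfun f 0 * j (unit_vec 0) + apply_bcontfun f 1 * b"
      unfolding b_def using e0 e1 by (simp only: add scale plane.scaleR_mem)
    finally show "j f = ?J f" using f j0 b0 by simp
  qed simp
qed

theorem proposition3p3:
  shows "(\<forall>(X :: 'a::real_vector set) N K.
            banach_space_on X N \<and> uniformly_convex_on X N \<and> uniformly_smooth_on X N \<and>
            K \<subseteq> X \<and> closedin (norm_topology X N) K \<and> convex K \<and> pointed_cone K \<longrightarrow>
            (\<forall>x\<in>X. \<forall>t>0.
               metric_projection N K (t *\<^sub>R x) = t *\<^sub>R metric_projection N K x)) \<and>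
         (\<exists>(X :: (nat \<Rightarrow>\<^sub>C real) set) N K.
            banach_space_on X N \<and> uniformly_convex_on X N \<and> uniformly_smooth_on X N \<and>
            K \<subseteq> X \<and> closedin (norm_topology X N) K \<and> convex K \<and> pointed_cone K \<and>
            (\<exists>w\<in>X. duality_map X N w (metric_projection N K w)
                      \<noteq> (N (metric_projection N K w))\<^sup>2))"
proof (intro conjI allI impI ballI)
  fix X :: "'a set" and N K x and t :: real
  assume "banach_space_on X N \<and> uniformly_convex_on X N \<and> uniformly_smooth_on X N \<and>
    K \<subseteq> X \<and> closedin (norm_topology X N) K \<and> convex K \<and> pointed_cone K"
    and "x \<in> X" "0 < t"
  then show "metric_projection N K (t *\<^sub>R x) = t *\<^sub>R metric_projection N K x"
    by (auto simp: pointed_cone_def intro: banach_space_on.metric_projection_cone_scaleR)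
next
  let ?p = "metric_projection l4 diagonal_ray (unit_vec 0)"
  have "?p \<in> plane"
    unfolding metric_projection_diagonal_ray by (auto simp: plane_def)
  then have J: "duality_map plane l4 (unit_vec 0) ?p = 1/2"
    by (simp add: duality_map_unit_vec metric_projection_diagonal_ray)
  \<comment> \<open>The norm of the projection is a fourth root, so the supposed equality is refuted
    after squaring: 1/4 against 1/8.\<close>
  have N: "((l4 ?p)\<^sup>2)\<^sup>2 = 1/8"
    using l4_power4[of ?p] by (simp add: metric_projection_diagonal_ray power4_eq_xxxx)
  have "duality_map plane l4 (unit_vec 0) ?p \<noteq> (l4 ?p)\<^sup>2"
  proof
    assume "duality_map plane l4 (unit_vec 0) ?p = (l4 ?p)\<^sup>2"
    then have "(1/2 :: real)\<^sup>2 = 1/8" using J N by metis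
    then show False by (simp add: power2_eq_square)
  qed
  then show "\<exists>(X :: (nat \<Rightarrow>\<^sub>C real) set) N K.
      banach_space_on X N \<and> uniformly_convex_on X N \<and> uniformly_smooth_on X N \<and>
      K \<subseteq> X \<and> closedin (norm_topology X N) K \<and> convex K \<and> pointed_cone K \<and>
      (\<exists>w\<in>X. duality_map X N w (metric_projection N K w) \<noteq> (N (metric_projection N K w))\<^sup>2)"
    using banach_space_on_plane uniformly_convex_on_plane uniformly_smooth_on_plane
      closedin_diagonal_ray convex_diagonal_ray pointed_cone_diagonal_ray unit_vec_in_plane[of 0]
    by (intro exI[of _ plane] exI[of _ l4] exI[of _ diagonal_ray]) (auto simp: diagonal_ray_def)
qed

end
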